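(* Consider a family of models indexed by $d_x\in\mathbb N$ with likelihoods $$g^{d_x}(y\mid x)=\phi\big(\psi(\|y-h^{d_x}(x)\|_R)\big),\qquad x\in\mathcal X\subseteq\mathbb R^{d_x},\ y\in\mathcal Y=\mathbb R^{d_y},$$ where $d_y$, the symmetric positive definite matrix $R\in\mathbb R^{d_y\times d_y}$ and the radial profile $(\phi,\psi)$ do not depend on $d_x$, and $M(d_x):=\sup_{x\in\mathcal X}\|h^{d_x}(x)\|<\infty$ for every $d_x$. Put $M_R^{d_x}:=\sup_{x\in\mathcal X}\|h^{d_x}(x)\|_R$. Assume that $(\phi,\psi)$ is one of the noise models of Table A or Table B (listed in the context). Then, for every $d_x$, the integral $$\int_0^\infty\frac{\phi^2(\psi(r))}{\phi(\psi(r+2M_R^{d_x}))}\,r^{d_y-1}\,\mathrm dr$$ is finite, and therefore $K_2^{d_x}=\mathbb E\big[\|\ell_Y^{\,d_x}\|_{L^2(\pi_0)}^2\big]<\infty$; hence $\ell^{\,d_x}$ is Bochner $2$-integrable. Furthermore: 1. If there is $M<\infty$ with $\sup_{d_x\in\mathbb N}M(d_x)\le M$, then, for all noise models in Tables A and B, there is a constant $\mathcal K_2<\infty$, independent of $d_x$, with $\sup_{d_x\in\mathbb N}K_2^{d_x}\le\mathcal K_2$. 2. For the noise models in Table B, if $M(d_x)\le P(d_x)$ for all $d_x\in\mathbb N$ for some polynomial $P$, then there is a polynomial $P_{n,2}$ (of some degree $n$) such that $K_2^{d_x}\le P_{n,2}(d_x)$ for all $d_x\in\mathbb N$.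
   Context: For each $d_x$: $\mathcal X\subseteq\mathbb R^{d_x}$ is Borel, $\pi_0$ is a probability measure on $\mathcal X$ (both depend on $d_x$), $h^{d_x}:\mathcal X\to\mathcal Y$ is measurable, and given $X=x$ the observation $Y=h^{d_x}(X)+V$ (with $V$ independent of $X\sim\pi_0$) has density $g^{d_x}(\cdot\mid x)$ w.r.t. Lebesgue measure. $\|\cdot\|$ is the Euclidean norm and $\|y\|_R:=\sqrt{y^\top Ry}$. Write $g_y^{d_x}(x):=g^{d_x}(y\mid x)$ and $\pi_0(g_y^{d_x}):=\int g_y^{d_x}\,\mathrm d\pi_0$. The marginal law of $Y$ is $\eta(\mathrm dy)=\pi_0(g_y^{d_x})\,\mathrm dy$. The link function is $\ell^{\,d_x}:\mathcal Y\to L^2(\pi_0)$, $\ell_y^{\,d_x}:=g_y^{d_x}(\cdot)/\pi_0(g_y^{d_x})$. It is Bochner $2$-integrable (w.r.t. $\eta$) iff it is strongly $\eta$-measurable and $K_2^{d_x}:=\int_{\mathcal Y}\|\ell_y^{\,d_x}\|_{L^2(\pi_0)}^2\,\eta(\mathrm dy)=\mathbb E[\|\ell_Y^{\,d_x}\|_{L^2(\pi_0)}^2]<\infty$. Table A (exponential-type profile, $\phi(s)=\mathrm C\,e^{-s}$): - Gaussian: $\psi(r)=\tfrac12r^2$; - generalized Gaussian: $\psi(r)=r^\beta$, $\beta>0$; - Laplace: $\psi(r)=r$; - sub-Gaussian: $\psi(r)=a r^2$, $a>0$. Table B (polynomial, heavy-tailed profile, $\phi(s)=\mathrm C\,s^{-\alpha}$,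 used for $s\ge1$): - Student-$t$ ($\nu>0$): $\psi(r)=1+\tfrac1\nu r^2$, $\alpha=\tfrac{\nu+d_y}2$; - Cauchy: $\psi(r)=1+r^2$, $\alpha=\tfrac{d_y+1}2$; - Pearson type VII ($\lambda>0$): $\psi(r)=1+\tfrac1\lambda r^2$, $\alpha>0$; - generalized Cauchy / rational quadratic: $\psi(r)=1+r^p$, $p\in\mathbb N$ (here $p\ge1$), $\alpha>0$. In all cases $\mathrm C>0$ is the normalization constant making $y\mapsto\phi(\psi(\|y\|_R))$ a probability density on $\mathbb R^{d_y}$; in particular the parameters are assumed to be such that this function is integrable. *)

theory Defs
  imports "HOL-Probability.Probability" "HOL-Computational_Algebra.Polynomial"
begin

text \<open>
  The dimension \<open>d\<close> of the parameter space varies inside the statement, so \<open>\<real>\<^sup>d\<close> is the space of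
  (extensional) functions on \<open>{..<d}\<close> with its Borel sigma-algebra. The dimension of the data space is
  fixed, so that space is a type \<open>real ^ 'm\<close> with \<open>CARD('m)\<close> for its dimension.
\<close>

abbreviation borel_Rn :: "nat \<Rightarrow> (nat \<Rightarrow> real) measure" where
  "borel_Rn d \<equiv> PiM {..<d} (\<lambda>_. borel)"

definition sym_pos_def :: "real ^ 'm ^ 'm \<Rightarrow> bool" where
  "sym_pos_def R \<longleftrightarrow> transpose R = R \<and> (\<forall>v. v \<noteq> 0 \<longrightarrow> v \<bullet> (R *v v) > 0)"

definition norm_wrt :: "real ^ 'm ^ 'm \<Rightarrow> real ^ 'm \<Rightarrow> real" where
  "norm_wrt R y = sqrt (y \<bullet> (R *v y))"

text \<open>
  Independence of two random variables; the library's \<open>indep_var\<close> needs both to have the same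
  value type. The families below are the generated sigma-algebras.
\<close>

definition independent_rvs ::
    "'w measure \<Rightarrow> 'a measure \<Rightarrow> ('w \<Rightarrow> 'a) \<Rightarrow> 'b measure \<Rightarrow> ('w \<Rightarrow> 'b) \<Rightarrow> bool" where
  "independent_rvs W A f B f' \<longleftrightarrow>
     f \<in> W \<rightarrow>\<^sub>M A \<and> f' \<in> W \<rightarrow>\<^sub>M B \<and>
     prob_space.indep_set W {f -` S \<inter> space W | S. S \<in> sets A} {f' -` S \<inter> space W | S. S \<in> sets B}"

text \<open>
  Noise models, as pairs \<open>\<phi> \<psi>\<close>; only the values \<open>\<psi> r\<close> for \<open>r \<ge> 0\<close> and \<open>\<phi> (\<psi> r)\<close> matter. The
  parameter \<open>C\<close> is any positive constant here; the requirement that \<open>\<phi> (\<psi> (norm_wrt R y))\<close> be a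
  probability density, which fixes \<open>C\<close> and restricts \<open>\<alpha>\<close>, depends on \<open>R\<close> and is imposed separately.
\<close>

inductive exponential_noise :: "(real \<Rightarrow> real) \<Rightarrow> (real \<Rightarrow> real) \<Rightarrow> bool" where
  gaussian: "C > 0 \<Longrightarrow> exponential_noise (\<lambda>s. C * exp (- s)) (\<lambda>r. r\<^sup>2 / 2)"
| generalized_gaussian: "C > 0 \<Longrightarrow> \<beta> > 0 \<Longrightarrow> exponential_noise (\<lambda>s. C * exp (- s)) (\<lambda>r. r powr \<beta>)"
| laplace: "C > 0 \<Longrightarrow> exponential_noise (\<lambda>s. C * exp (- s)) (\<lambda>r. r)"
| sub_gaussian: "C > 0 \<Longrightarrow> a > 0 \<Longrightarrow> exponential_noise (\<lambda>s. C * exp (- s)) (\<lambda>r. a * r\<^sup>2)"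

inductive polynomial_noise :: "nat \<Rightarrow> (real \<Rightarrow> real) \<Rightarrow> (real \<Rightarrow> real) \<Rightarrow> bool" for dy :: nat where
  student: "C > 0 \<Longrightarrow> \<nu> > 0 \<Longrightarrow>
    polynomial_noise dy (\<lambda>s. C * s powr - ((\<nu> + real dy) / 2)) (\<lambda>r. 1 + r\<^sup>2 / \<nu>)"
| cauchy: "C > 0 \<Longrightarrow>
    polynomial_noise dy (\<lambda>s. C * s powr - ((real dy + 1) / 2)) (\<lambda>r. 1 + r\<^sup>2)"
| pearson_VII: "C > 0 \<Longrightarrow> \<theta> > 0 \<Longrightarrow> \<alpha> > 0 \<Longrightarrow>
    polynomial_noise dy (\<lambda>s. C * s powr - \<alpha>) (\<lambda>r. 1 + r\<^sup>2 / \<theta>)"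
| generalized_cauchy: "C > 0 \<Longrightarrow> p \<ge> (1::nat) \<Longrightarrow> \<alpha> > 0 \<Longrightarrow>
    polynomial_noise dy (\<lambda>s. C * s powr - \<alpha>) (\<lambda>r. 1 + r ^ p)"

text \<open>
  \<open>L\<^sup>2(M)\<close> is represented by functions rather than by classes modulo \<open>M\<close>-a.e. equality.
  The norm takes the value \<open>\<infinity>\<close> outside \<open>L\<^sup>2\<close>.
\<close>

definition Ltwo_norm :: "'a measure \<Rightarrow> ('a \<Rightarrow> real) \<Rightarrow> ennreal" where
  "Ltwo_norm M f = (let I = (\<integral>\<^sup>+ x. ennreal ((f x)\<^sup>2) \<partial>M) in
     if I = \<infinity> then \<infinity> else ennreal (sqrt (enn2real I)))"

definition Ltwo :: "'a measure \<Rightarrow> ('a \<Rightarrow> real) set" where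
  "Ltwo M = {f \<in> borel_measurable M. Ltwo_norm M f < \<infinity>}"

text \<open>
  Almost everywhere limit of simple functions. That the simple functions take values in
  representatives is no restriction: choose one representative for each of the finitely many values.
\<close>

definition strongly_measurable_Ltwo ::
    "'y measure \<Rightarrow> 'x measure \<Rightarrow> ('y \<Rightarrow> 'x \<Rightarrow> real) \<Rightarrow> bool" where
  "strongly_measurable_Ltwo N M F \<longleftrightarrow>
     (\<exists>s :: nat \<Rightarrow> 'y \<Rightarrow> 'x \<Rightarrow> real.
        (\<forall>n. simple_function N (s n) \<and> (\<forall>y \<in> space N. s n y \<in> Ltwo M)) \<and>
        (AE y in N. (\<lambda>n. Ltwo_norm M (\<lambda>x. s n y x - F y x)) \<longlonglongrightarrow> 0))"

definition bochner_two_integrable ::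
    "'y measure \<Rightarrow> 'x measure \<Rightarrow> ('y \<Rightarrow> 'x \<Rightarrow> real) \<Rightarrow> bool" where
  "bochner_two_integrable N M F \<longleftrightarrow>
     (\<forall>y \<in> space N. F y \<in> Ltwo M) \<and> strongly_measurable_Ltwo N M F \<and>
     (\<integral>\<^sup>+ y. (Ltwo_norm M (F y))\<^sup>2 \<partial>N) < \<infinity>"

text \<open>In the following, \<open>g y x\<close> is the likelihood of \<open>y\<close> given \<open>x\<close>, and \<open>M\<close> is the prior.\<close>

definition evidence :: "'x measure \<Rightarrow> ('y \<Rightarrow> 'x \<Rightarrow> real) \<Rightarrow> 'y \<Rightarrow> real" where
  "evidence M g y = (\<integral>x. g y x \<partial>M)"

definition data_law :: "'x measure \<Rightarrow> ('y::euclidean_space \<Rightarrow> 'x \<Rightarrow> real) \<Rightarrow> 'y measure" where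
  "data_law M g = density lborel (\<lambda>y. ennreal (evidence M g y))"

definition link_fun :: "'x measure \<Rightarrow> ('y \<Rightarrow> 'x \<Rightarrow> real) \<Rightarrow> 'y \<Rightarrow> 'x \<Rightarrow> real" where
  "link_fun M g y = (\<lambda>x. g y x / evidence M g y)"

definition K_two :: "'x measure \<Rightarrow> ('y::euclidean_space \<Rightarrow> 'x \<Rightarrow> real) \<Rightarrow> ennreal" where
  "K_two M g = (\<integral>\<^sup>+ y. (Ltwo_norm M (link_fun M g y))\<^sup>2 \<partial>data_law M g)"

end

(*
  Write F = \<phi> \<circ> \<psi> and let B bound norm_wrt R (h x) for x in X. Since F is
  decreasing, the triangle inequality gives evidence(y) >= F (norm_wrt R (y - h x) + 2 B) for every
  x, so by Tonelli and translation invariance K_two is at most the integral of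
  F(r)^2 / F(r + 2 B) over r = norm_wrt R v. In all noise models this ratio is at most
  K(2 B) F(r / c), with a scale c and an increasing K depending only on the model: c > 1 absorbs the
  exponential factor in Table A, and in Table B c = 1 and K is a polynomial. As F integrates to
  one, K_two is at most K(2 B) c^m. The one-dimensional integral is compared with the
  same majorant through polar coordinates. Strong measurability of the link function follows from
  its continuity as a map into L^2.
*)
theory Submission
  imports Defs
begin

subsection \<open>The norm induced by a positive definite matrix\<close>

lemma sym_pos_def_inner_commute:
  assumes "sym_pos_def R"
  shows "v \<bullet> (R *v w) = w \<bullet> (R *v v)"
  using assms by (metis dot_lmul_matrix inner_commute sym_pos_def_def vector_transpose_matrix)

lemma sym_pos_def_nonneg:
  assumes "sym_pos_def R"
  shows "0 \<le> v \<bullet> (R *v v)"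
  using assms by (cases "v = 0") (auto simp: sym_pos_def_def less_imp_le)

lemma norm_wrt_nonneg:
  assumes "sym_pos_def R"
  shows "0 \<le> norm_wrt R v"
  using sym_pos_def_nonneg[OF assms] by (simp add: norm_wrt_def)

lemma norm_wrt_power2:
  assumes "sym_pos_def R"
  shows "(norm_wrt R v)\<^sup>2 = v \<bullet> (R *v v)"
  using sym_pos_def_nonneg[OF assms] by (simp add: norm_wrt_def)

lemma norm_wrt_scaleR: "norm_wrt R (c *\<^sub>R v) = \<bar>c\<bar> * norm_wrt R v"
proof -
  have "(c *\<^sub>R v) \<bullet> (R *v (c *\<^sub>R v)) = c\<^sup>2 * (v \<bullet> (R *v v))"
    by (simp add: matrix_vector_mult_scaleR power2_eq_square)
  then show ?thesis
    by (simp add: norm_wrt_def real_sqrt_mult)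
qed

lemma norm_wrt_minus: "norm_wrt R (- v) = norm_wrt R v"
  using norm_wrt_scaleR[of R "-1" v] by simp

lemma norm_wrt_eq_0_iff:
  assumes "sym_pos_def R"
  shows "norm_wrt R v = 0 \<longleftrightarrow> v = 0"
  using assms by (auto simp: norm_wrt_def sym_pos_def_def) 

lemma norm_wrt_Cauchy_Schwarz:
  assumes R: "sym_pos_def R"
  shows "v \<bullet> (R *v w) \<le> norm_wrt R v * norm_wrt R w"
proof (cases "w = 0")
  case True
  then show ?thesis by (simp add: norm_wrt_def)
next
  case False
  define a b c where "a = v \<bullet> (R *v v)" and "b = v \<bullet> (R *v w)" and "c = w \<bullet> (R *v w)"
  have c: "c > 0" using R False by (simp add: c_def sym_pos_def_def)
  \<comment> \<open>Up to the factor \<open>c\<close>, this vector is the component of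
    \<open>v\<close> orthogonal to \<open>w\<close> with respect to the form; scaling by
    \<open>c\<close> avoids a division.\<close>
  have "0 \<le> (c *\<^sub>R v - b *\<^sub>R w) \<bullet> (R *v (c *\<^sub>R v - b *\<^sub>R w))"
    by (rule sym_pos_def_nonneg[OF R])
  also have "\<dots> = c * (a * c - b\<^sup>2)"
    using sym_pos_def_inner_commute[OF R, of w v]
    by (simp add: a_def b_def c_def matrix_vector_mult_diff_distrib matrix_vector_mult_scaleR
        inner_diff_left inner_diff_right algebra_simps power2_eq_square)
  finally have "b\<^sup>2 \<le> a * c" using c by (simp add: zero_le_mult_iff)
  also have "\<dots> = (norm_wrt R v * norm_wrt R w)\<^sup>2"
    using R by (simp add: power_mult_distrib norm_wrt_power2 a_def c_def)
  finally have "b\<^sup>2 \<le> (norm_wrt R v * norm_wrt R w)\<^sup>2" .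
  then show ?thesis
    unfolding b_def by (rule power2_le_imp_le) (simp add: norm_wrt_nonneg R)
qed

lemma norm_wrt_triangle:
  assumes R: "sym_pos_def R"
  shows "norm_wrt R (v + w) \<le> norm_wrt R v + norm_wrt R w"
proof (rule power2_le_imp_le)
  have "(norm_wrt R (v + w))\<^sup>2 = (norm_wrt R v)\<^sup>2 + 2 * (v \<bullet> (R *v w)) + (norm_wrt R w)\<^sup>2"
    using sym_pos_def_inner_commute[OF R, of w v]
    by (simp add: norm_wrt_power2[OF R] matrix_vector_right_distrib inner_add_left inner_add_right)
  also have "\<dots> \<le> (norm_wrt R v + norm_wrt R w)\<^sup>2"
    using norm_wrt_Cauchy_Schwarz[OF R, of v w] by (simp add: power2_sum)
  finally show "(norm_wrt R (v + w))\<^sup>2 \<le> (norm_wrt R v + norm_wrt R w)\<^sup>2" .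
qed (simp add: norm_wrt_nonneg R)

lemma continuous_norm_wrt [continuous_intros]: "continuous_on A (norm_wrt R)"
  unfolding norm_wrt_def
  by (intro continuous_intros linear_continuous_on matrix_vector_mul_bounded_linear)

lemma borel_measurable_norm_wrt [measurable]: "norm_wrt R \<in> borel_measurable borel"
  by (rule borel_measurable_continuous_onI) (rule continuous_norm_wrt)

text \<open>Turns the given bounds on the Euclidean norm of the signal into bounds on its
  \<open>R\<close>-norm, with a factor that depends on \<open>R\<close> alone and hence not on the
  dimension \<open>d\<close>.\<close>

lemma norm_wrt_le_norm:
  obtains k where "k > 0" "\<And>v. norm_wrt R v \<le> k * norm v"
proof -
  obtain b where b: "b > 0" "\<And>v. norm (R *v v) \<le> norm v * b"
    using bounded_linear.pos_bounded[OF matrix_vector_mul_bounded_linear[of R]] by blast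
  have "norm_wrt R v \<le> sqrt b * norm v" for v
  proof -
    have "v \<bullet> (R *v v) \<le> norm v * norm (R *v v)"
      by (rule norm_cauchy_schwarz)
    also have "\<dots> \<le> norm v * (norm v * b)"
      using b(2) by (rule mult_left_mono) simp
    also have "\<dots> = b * (norm v)\<^sup>2" by (simp add: power2_eq_square)
    finally show ?thesis
      unfolding norm_wrt_def
      by (metis norm_ge_zero real_sqrt_le_mono real_sqrt_mult real_sqrt_unique)
  qed
  with b(1) that[of "sqrt b"] show thesis by simp
qed

subsection \<open>Radial integrals\<close>

text \<open>Change of variables. With \<open>t = 0\<close> it rescales balls and profiles, with
  \<open>t = h x\<close> it undoes the shift of the noise by the signal.\<close>

lemma nn_integral_lborel_affine:
  fixes f :: "'a::euclidean_space \<Rightarrow> ennreal"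
  assumes [measurable]: "f \<in> borel_measurable borel" and c: "c \<noteq> 0"
  shows "(\<integral>\<^sup>+ v. f v \<partial>lborel) = ennreal (\<bar>c\<bar> ^ DIM('a)) * (\<integral>\<^sup>+ v. f (t + c *\<^sub>R v) \<partial>lborel)"
proof -
  have "(\<integral>\<^sup>+ v. f v \<partial>lborel) =
      (\<integral>\<^sup>+ v. f v \<partial>density (distr lborel borel (\<lambda>v. t + c *\<^sub>R v)) (\<lambda>_. \<bar>c\<bar> ^ DIM('a)))"
    using lborel_affine[OF c, of t] by simp
  also have "\<dots> = (\<integral>\<^sup>+ v. ennreal (\<bar>c\<bar> ^ DIM('a)) * f (t + c *\<^sub>R v) \<partial>lborel)"
    by (simp add: nn_integral_density nn_integral_distr)
  finally show ?thesis by (simp add: nn_integral_cmult)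
qed

text \<open>Dilation by \<open>r\<close> maps the unit ball onto the ball of radius
  \<open>r\<close>. Writing \<open>max 0 r\<close> covers the empty ball and the singleton as well,
  so that the formula holds on every half-line.\<close>

lemma emeasure_norm_wrt_le:
  fixes R :: "real ^ 'm ^ 'm"
  assumes R: "sym_pos_def R"
  shows "emeasure lborel {v. norm_wrt R v \<le> r} =
    ennreal ((max 0 r) ^ CARD('m)) * emeasure lborel {v. norm_wrt R v \<le> 1}"
proof -
  consider "r < 0" | "r = 0" | "r > 0" by linarith
  then show ?thesis
  proof cases
    case 1
    then have "{v. norm_wrt R v \<le> r} = {}"
      using norm_wrt_nonneg[OF R] by (auto simp: not_le intro: less_le_trans)
    with 1 show ?thesis by (simp add: max_absorb1 power_0_left)
  next
    case 2
    then have "{v. norm_wrt R v \<le> r} = {0}"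
      using norm_wrt_nonneg[OF R] norm_wrt_eq_0_iff[OF R] by (auto simp: order_antisym_conv)
    with 2 show ?thesis by (simp add: power_0_left)
  next
    case 3
    have "emeasure lborel {v. norm_wrt R v \<le> r} =
        (\<integral>\<^sup>+ v. indicator {v. norm_wrt R v \<le> r} v \<partial>lborel)"
      by (simp add: nn_integral_indicator)
    also have "\<dots> = ennreal (r ^ CARD('m)) *
        (\<integral>\<^sup>+ v. indicator {v. norm_wrt R v \<le> r} (r *\<^sub>R v) \<partial>lborel)"
      using nn_integral_lborel_affine[of "indicator {v. norm_wrt R v \<le> r}" r 0] 3 by simp
    also have "(\<lambda>v. indicator {v. norm_wrt R v \<le> r} (r *\<^sub>R v)) =
        (indicator {v. norm_wrt R v \<le> 1} :: _ \<Rightarrow> ennreal)"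
      using 3 by (auto simp: fun_eq_iff indicator_def norm_wrt_scaleR)
    also have "(\<integral>\<^sup>+ v. indicator {v. norm_wrt R v \<le> 1} v \<partial>lborel) = emeasure lborel {v. norm_wrt R v \<le> 1}"
      by (simp add: nn_integral_indicator)
    finally show ?thesis using 3 by simp
  qed
qed

text \<open>The ball contains an open neighbourhood of \<open>0\<close>. Positivity lets finiteness
  pass from the integral over the data space to the one-dimensional integral.\<close>

lemma emeasure_norm_wrt_ball_pos:
  fixes R :: "real ^ 'm ^ 'm"
  shows "emeasure lborel {v. norm_wrt R v \<le> 1} > 0"
proof -
  have "open {v. norm_wrt R v < 1}"
    by (intro open_Collect_less continuous_intros)
  moreover have "0 \<in> {v. norm_wrt R v < 1}" by (simp add: norm_wrt_def)
  ultimately have "\<not> negligible {v. norm_wrt R v < 1}"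
    using open_not_negligible by blast
  then have "{v. norm_wrt R v < 1} \<notin> null_sets lborel"
    unfolding negligible_iff_null_sets using null_sets_completionI by blast
  then have "0 < emeasure lborel {v. norm_wrt R v < 1}"
    by (auto simp: null_sets_def zero_less_iff_neq_zero)
  also have "\<dots> \<le> emeasure lborel {v. norm_wrt R v \<le> 1}"
    by (rule emeasure_mono) auto
  finally show ?thesis .
qed

text \<open>By the fundamental theorem of calculus. The right-hand side is, up to a constant factor,
  the volume of the \<open>norm_wrt R\<close> ball of radius \<open>x\<close>.\<close>

lemma emeasure_power_density_atMost:
  assumes n: "n > 0"
  shows "emeasure (density lborel (\<lambda>r. ennreal (real n * r ^ (n - 1)) * indicator {0<..} r)) {..x::real} =
    ennreal ((max 0 x) ^ n)"
proof -
  have "emeasure (density lborel (\<lambda>r. ennreal (real n * r ^ (n - 1)) * indicator {0<..} r)) {..x} =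
      (\<integral>\<^sup>+ r. ennreal (real n * r ^ (n - 1)) * indicator {0<..} r * indicator {..x} r \<partial>lborel)"
    by (simp add: emeasure_density)
  \<comment> \<open>The integrands can differ only at \<open>0\<close>, which is added to obtain a
    closed interval.\<close>
  also have "\<dots> = (\<integral>\<^sup>+ r. ennreal (real n * r ^ (n - 1)) * indicator {0..max 0 x} r \<partial>lborel)"
    using AE_lborel_singleton[of "0::real"]
    by (intro nn_integral_cong_AE, eventually_elim) (auto split: split_indicator)
  also have "\<dots> = ennreal ((max 0 x) ^ n - 0 ^ n)"
  proof (rule nn_integral_FTC_Icc)
    fix r :: real
    show "((\<lambda>r. r ^ n) has_real_derivative real n * r ^ (n - 1)) (at r)"
      using DERIV_pow[of n r] by simp
  qed auto
  finally show ?thesis using n by (simp add: power_0_left)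
qed

text \<open>Polar coordinates: both sides are integrals against measures on the line that agree on the
  half-lines up to \<open>x\<close>, since the balls of \<open>norm_wrt R\<close> scale.\<close>

lemma nn_integral_norm_wrt:
  fixes R :: "real ^ 'm ^ 'm" and f :: "real \<Rightarrow> ennreal"
  assumes R: "sym_pos_def R"
    and fin: "emeasure lborel {v. norm_wrt R v \<le> 1} < \<infinity>"
    and f [measurable]: "f \<in> borel_measurable borel"
  shows "(\<integral>\<^sup>+ v. f (norm_wrt R v) \<partial>lborel) =
    emeasure lborel {v. norm_wrt R v \<le> 1} * ennreal (real CARD('m)) *
      (\<integral>\<^sup>+ r. f r * ennreal (r ^ (CARD('m) - 1)) * indicator {0<..} r \<partial>lborel)"
proof -
  define b where "b = emeasure lborel {v. norm_wrt R v \<le> 1}"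
  define D where
    "D = density lborel (\<lambda>r::real. ennreal (real CARD('m) * r ^ (CARD('m) - 1)) * indicator {0<..} r)"
  define N where "N = scale_measure b D"
  have N: "emeasure N {..x} = b * ennreal ((max 0 x) ^ CARD('m))" for x
    using emeasure_power_density_atMost[of "CARD('m)" x] by (simp add: N_def D_def)
  have L: "emeasure (distr lborel borel (norm_wrt R)) {..x} = b * ennreal ((max 0 x) ^ CARD('m))" for x
  proof -
    have "emeasure (distr lborel borel (norm_wrt R)) {..x} = emeasure lborel {v. norm_wrt R v \<le> x}"
      by (simp add: emeasure_distr vimage_def)
    then show ?thesis
      using emeasure_norm_wrt_le[OF R, of x] by (simp add: b_def mult.commute)
  qed
  have "distr lborel borel (norm_wrt R) = N"
  proof (rule measure_eqI_generator_eq[where E = "range atMost" and \<Omega> = UNIV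
        and A = "\<lambda>i. {..real i}"])
    show "Int_stable (range (atMost :: real \<Rightarrow> _))"
      by (auto simp: Int_stable_def)
    show "sets (distr lborel borel (norm_wrt R)) = sigma_sets UNIV (range atMost)"
      by (simp add: borel_eq_atMost)
    show "sets N = sigma_sets UNIV (range atMost)"
      by (simp add: N_def D_def borel_eq_atMost)
    show "(\<Union>i. {..real i}) = UNIV"
      using real_arch_simple by auto
    \<comment> \<open>Uniqueness of measures needs an exhaustion by sets of finite measure;
      finiteness of the unit ball supplies it.\<close>
    show "emeasure (distr lborel borel (norm_wrt R)) {..real i} \<noteq> \<infinity>" for i
      unfolding L using fin by (auto simp: b_def ennreal_mult_eq_top_iff)
  qed (auto simp: N L)
  moreover have "(\<integral>\<^sup>+ r. f r \<partial>distr lborel borel (norm_wrt R)) =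
      (\<integral>\<^sup>+ v. f (norm_wrt R v) \<partial>lborel)"
    by (simp add: nn_integral_distr)
  ultimately have "(\<integral>\<^sup>+ v. f (norm_wrt R v) \<partial>lborel) = (\<integral>\<^sup>+ r. f r \<partial>N)"
    by simp
  also have "\<dots> = b * (\<integral>\<^sup>+ r. f r \<partial>D)"
    unfolding N_def by (rule nn_integral_scale_measure) (simp add: D_def)
  also have "(\<integral>\<^sup>+ r. f r \<partial>D) = (\<integral>\<^sup>+ r. ennreal (real CARD('m)) *
      (f r * ennreal (r ^ (CARD('m) - 1)) * indicator {0<..} r) \<partial>lborel)"
    unfolding D_def
    by (subst nn_integral_density)
      (auto intro!: nn_integral_cong simp: ennreal_mult' ac_simps split: split_indicator)
  also have "\<dots> = ennreal (real CARD('m)) *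
      (\<integral>\<^sup>+ r. f r * ennreal (r ^ (CARD('m) - 1)) * indicator {0<..} r \<partial>lborel)"
    by (rule nn_integral_cmult) simp
  finally show ?thesis by (simp add: b_def mult.assoc)
qed

subsection \<open>Noise profiles\<close>

text \<open>\<open>F\<close> stands for \<phi> composed with \<psi>, evaluated at norms, hence the
  restriction to nonnegative arguments. All that is kept of a noise model is
  \<open>ratio_le\<close>: a shift by \<open>s\<close> costs a factor \<open>K s\<close> and a
  widening by \<open>c\<close>. Both are parameters because the growth of \<open>K\<close> decides
  how the final bound depends on the signal.\<close>

locale radial_profile =
  fixes F :: "real \<Rightarrow> real" and c :: real and K :: "real \<Rightarrow> real"
  assumes continuous: "continuous_on {0..} F"
    and pos: "0 \<le> r \<Longrightarrow> 0 < F r"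
    and antimono: "0 \<le> r \<Longrightarrow> r \<le> s \<Longrightarrow> F s \<le> F r"
    and scale_pos: "0 < c"
    and factor_mono: "0 \<le> s \<Longrightarrow> s \<le> t \<Longrightarrow> K s \<le> K t"
    and ratio_le: "0 \<le> r \<Longrightarrow> 0 \<le> s \<Longrightarrow> (F r)\<^sup>2 / F (r + s) \<le> K s * F (r / c)"

text \<open>Allows a tabulated profile to be replaced by its \<open>powr\<close> form, an
  identification made only for nonnegative arguments.\<close>

lemma radial_profile_cong:
  assumes "radial_profile F c K" and eq: "\<And>r. 0 \<le> r \<Longrightarrow> G r = F r"
  shows "radial_profile G c K"
proof -
  interpret radial_profile F c K by fact
  have "continuous_on {0..} G"
    using continuous eq by (subst continuous_on_cong[OF refl, of _ _ F]) auto
  with pos antimono scale_pos factor_mono ratio_le show ?thesis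
    by (simp add: radial_profile_def eq)
qed

text \<open>The ratio is \<open>C * exp (a * ((r + s) powr b - 2 * r powr b))\<close>. If
  \<open>(r + s) powr b\<close> exceeds \<open>3/2 * r powr b\<close> by a function of
  \<open>s\<close> at most, then a decay of \<open>r powr b / 2\<close> is left, which is that of
  the profile at \<open>r / c\<close> when \<open>c powr b = 2\<close>.\<close>

lemma exponential_profile:
  assumes C: "C > 0" and a: "a > 0" and b: "b > 0"
  shows "\<exists>c K. radial_profile (\<lambda>r. C * exp (- (a * r powr b))) c K"
proof -
  \<comment> \<open>Chosen so that \<open>r + s \<le> q * r\<close> costs exactly the factor
    \<open>3/2\<close>; any factor strictly between 1 and 2 would leave some decay.\<close>
  define q :: real where "q = (3/2) powr (1 / b)"
  have q: "q > 1" unfolding q_def using b by (simp add: gr_one_powr)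
  have qb: "q powr b = 3/2" unfolding q_def using b by (simp add: powr_powr)
  \<comment> \<open>In the opposite case \<open>r\<close> is at most \<open>s / (q - 1)\<close>, so
    \<open>r + s \<le> t * s\<close>.\<close>
  define t where "t = 1 / (q - 1) + 1"
  have t: "t > 0" unfolding t_def using q by (simp add: add_pos_pos)
  define c :: real where "c = 2 powr (1 / b)"
  have c: "c > 0" by (simp add: c_def)
  have cb: "c powr b = 2" unfolding c_def using b by (simp add: powr_powr)
  have key: "(r + s) powr b \<le> 3/2 * r powr b + (t * s) powr b" if "0 \<le> r" "0 \<le> s" for r s
  proof (cases "s \<le> (q - 1) * r")
    case True
    then have "(r + s) powr b \<le> (q * r) powr b"
      using that b by (intro powr_mono2) (auto simp: algebra_simps)
    also have "\<dots> = 3/2 * r powr b"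
      using that q by (simp add: powr_mult qb)
    finally show ?thesis by (simp add: add_increasing2)
  next
    case False
    then have "r \<le> s / (q - 1)" using q by (simp add: pos_le_divide_eq mult.commute)
    then have "(r + s) powr b \<le> (t * s) powr b"
      using that b by (intro powr_mono2) (auto simp: t_def algebra_simps)
    then show ?thesis by (simp add: add_increasing)
  qed
  have "radial_profile (\<lambda>r. C * exp (- (a * r powr b))) c (\<lambda>s. exp (a * (t * s) powr b))"
  proof
    show "continuous_on {0..} (\<lambda>r. C * exp (- (a * r powr b)))"
      using b by (intro continuous_intros continuous_on_powr') auto
    show "C * exp (- (a * s powr b)) \<le> C * exp (- (a * r powr b))" if "0 \<le> r" "r \<le> s" for r s
      using that C a b by (simp add: powr_mono2)
    show "exp (a * (t * s) powr b) \<le> exp (a * (t * u) powr b)" if "0 \<le> s" "s \<le> u" for s u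
      using that a b t by (simp add: powr_mono2)
    show "(C * exp (- (a * r powr b)))\<^sup>2 / (C * exp (- (a * (r + s) powr b))) \<le>
        exp (a * (t * s) powr b) * (C * exp (- (a * (r / c) powr b)))" if "0 \<le> r" "0 \<le> s" for r s
    proof -
      have "(C * exp (- (a * r powr b)))\<^sup>2 / (C * exp (- (a * (r + s) powr b))) =
          C * exp (a * ((r + s) powr b - 2 * r powr b))"
        using C by (simp add: power2_eq_square field_simps exp_minus exp_diff exp_add[symmetric])
      also have "\<dots> \<le> C * exp (a * ((t * s) powr b - r powr b / 2))"
        using key[OF that] C a by simp
      also have "\<dots> = exp (a * (t * s) powr b) * (C * exp (- (a * (r / c) powr b)))"
        using that c cb by (simp add: powr_divide exp_add[symmetric] algebra_simps)
      finally show ?thesis .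
    qed
  qed (use C c in auto)
  then show ?thesis by blast
qed

text \<open>A shift by \<open>s\<close> enlarges \<open>1 + r ^ p / \<nu>\<close> by at most the
  factor \<open>(1 + 1 / \<nu>) * (1 + s) ^ p\<close>. Raised to the power \<alpha> this gives the
  factor, without widening, so the scale is 1. Rounding the exponent up makes the factor a
  polynomial in \<open>s\<close>.\<close>

lemma polynomial_profile:
  fixes p :: nat
  assumes C: "C > 0" and \<nu>: "\<nu> > 0" and \<alpha>: "\<alpha> > 0"
  shows "radial_profile (\<lambda>r. C * (1 + r ^ p / \<nu>) powr - \<alpha>) 1
    (\<lambda>s. (1 + 1 / \<nu>) powr \<alpha> * (1 + s) ^ nat \<lceil>real p * \<alpha>\<rceil>)"
proof
  have base: "1 + r ^ p / \<nu> > 0" if "0 \<le> r" for r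
    using that \<nu> by (simp add: add_pos_nonneg)
  show "continuous_on {0..} (\<lambda>r. C * (1 + r ^ p / \<nu>) powr - \<alpha>)"
    using base \<nu> by (intro continuous_intros) (auto simp: less_imp_neq[symmetric] dest: base)
  show "0 < C * (1 + r ^ p / \<nu>) powr - \<alpha>" if "0 \<le> r" for r
    using base[OF that] C by simp
  show "C * (1 + s ^ p / \<nu>) powr - \<alpha> \<le> C * (1 + r ^ p / \<nu>) powr - \<alpha>" if "0 \<le> r" "r \<le> s" for r s
    using that C \<nu> \<alpha> base[of r] by (intro mult_left_mono powr_mono2') (auto intro: divide_right_mono power_mono)
  show "(1 + 1 / \<nu>) powr \<alpha> * (1 + s) ^ nat \<lceil>real p * \<alpha>\<rceil> \<le> (1 + 1 / \<nu>) powr \<alpha> * (1 + t) ^ nat \<lceil>real p * \<alpha>\<rceil>"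
    if "0 \<le> s" "s \<le> t" for s t
    using that by (intro mult_left_mono power_mono) auto
  show "(C * (1 + r ^ p / \<nu>) powr - \<alpha>)\<^sup>2 / (C * (1 + (r + s) ^ p / \<nu>) powr - \<alpha>) \<le>
      (1 + 1 / \<nu>) powr \<alpha> * (1 + s) ^ nat \<lceil>real p * \<alpha>\<rceil> * (C * (1 + (r / 1) ^ p / \<nu>) powr - \<alpha>)"
    if r: "0 \<le> r" and s: "0 \<le> s" for r s
  proof -
    \<comment> \<open>For \<open>r \<le> 1\<close> use \<open>r + s \<le> 1 + s\<close>, for larger
      \<open>r\<close> use \<open>r + s \<le> (1 + s) * r\<close>; the factor
      \<open>1 + r ^ p\<close> dominates both outcomes.\<close>
    have "(r + s) ^ p \<le> (1 + s) ^ p * (1 + r ^ p)"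
    proof (cases "r \<le> 1")
      case True
      then have "(r + s) ^ p \<le> (1 + s) ^ p" using r s by (intro power_mono) auto
      also have "\<dots> \<le> (1 + s) ^ p * (1 + r ^ p)" using r s by simp
      finally show ?thesis .
    next
      case False
      then have "s * 1 \<le> s * r" using s by (intro mult_left_mono) auto
      then have "(r + s) ^ p \<le> ((1 + s) * r) ^ p"
        using r s by (intro power_mono) (auto simp: algebra_simps)
      also have "\<dots> \<le> (1 + s) ^ p * (1 + r ^ p)"
        using s by (simp add: power_mult_distrib mult.commute mult_left_mono)
      finally show ?thesis .
    qed
    \<comment> \<open>The summand 1 is absorbed by \<open>(1 + s) ^ p\<close>, which is at least
      1.\<close>
    then have "1 + (r + s) ^ p / \<nu> \<le> (1 + s) ^ p + (1 + s) ^ p * (1 + r ^ p) / \<nu>"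
      using s \<nu> by (intro add_mono divide_right_mono) auto
    also have "\<dots> \<le> (1 + s) ^ p * ((1 + 1 / \<nu>) * (1 + r ^ p / \<nu>))"
    proof -
      have "1 + (1 + r ^ p) / \<nu> \<le> (1 + 1 / \<nu>) * (1 + r ^ p / \<nu>)"
        using r \<nu> by (simp add: field_simps)
      from mult_left_mono[OF this, of "(1 + s) ^ p"] s show ?thesis
        by (simp add: algebra_simps)
    qed
    finally have "(1 + (r + s) ^ p / \<nu>) powr \<alpha> \<le>
        ((1 + s) ^ p * ((1 + 1 / \<nu>) * (1 + r ^ p / \<nu>))) powr \<alpha>"
      using base[of "r + s"] r s \<alpha> by (intro powr_mono2) auto
    also have "\<dots> = (1 + s) powr (real p * \<alpha>) * ((1 + 1 / \<nu>) powr \<alpha> * (1 + r ^ p / \<nu>) powr \<alpha>)"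
      using base[OF r] s \<nu> by (simp add: powr_mult powr_realpow[symmetric] powr_powr)
    also have "\<dots> \<le> (1 + s) ^ nat \<lceil>real p * \<alpha>\<rceil> * ((1 + 1 / \<nu>) powr \<alpha> * (1 + r ^ p / \<nu>) powr \<alpha>)"
    proof (rule mult_right_mono)
      have "(1 + s) powr (real p * \<alpha>) \<le> (1 + s) powr real (nat \<lceil>real p * \<alpha>\<rceil>)"
        using s by (intro powr_mono) linarith+
      then show "(1 + s) powr (real p * \<alpha>) \<le> (1 + s) ^ nat \<lceil>real p * \<alpha>\<rceil>"
        using s by (simp add: powr_realpow)
    qed simp
    finally have *: "(1 + (r + s) ^ p / \<nu>) powr \<alpha> \<le>
        (1 + s) ^ nat \<lceil>real p * \<alpha>\<rceil> * ((1 + 1 / \<nu>) powr \<alpha> * (1 + r ^ p / \<nu>) powr \<alpha>)" .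
    define u where "u = (1 + r ^ p / \<nu>) powr \<alpha>"
    have u: "u > 0" using base[OF r] by (simp add: u_def)
    have "(C * (1 + r ^ p / \<nu>) powr - \<alpha>)\<^sup>2 / (C * (1 + (r + s) ^ p / \<nu>) powr - \<alpha>) =
        C / u\<^sup>2 * (1 + (r + s) ^ p / \<nu>) powr \<alpha>"
      using C by (simp add: powr_minus_divide power2_eq_square u_def)
    also have "\<dots> \<le> C / u\<^sup>2 * ((1 + s) ^ nat \<lceil>real p * \<alpha>\<rceil> * ((1 + 1 / \<nu>) powr \<alpha> * u))"
      using * C by (intro mult_left_mono) (auto simp: u_def)
    also have "\<dots> = (1 + 1 / \<nu>) powr \<alpha> * (1 + s) ^ nat \<lceil>real p * \<alpha>\<rceil> * (C * (1 + (r / 1) ^ p / \<nu>) powr - \<alpha>)"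
      using u by (simp add: powr_minus_divide power2_eq_square flip: u_def)
    finally show ?thesis .
  qed
qed simp

text \<open>All entries have \<psi> of the form \<open>a * r powr b\<close>; the cases only read off
  \<open>a\<close> and \<open>b\<close>.\<close>

lemma exponential_noise_profile:
  assumes "exponential_noise \<phi> \<psi>"
  shows "\<exists>c K. radial_profile (\<lambda>r. \<phi> (\<psi> r)) c K"
proof -
  have *: "\<exists>c K. radial_profile G c K"
    if "C > 0" "a > 0" "b > 0" "\<And>r. 0 \<le> r \<Longrightarrow> G r = C * exp (- (a * r powr b))" for C a b G
    using exponential_profile[OF that(1-3)] radial_profile_cong[where G = G, OF _ that(4)] by blast
  from assms show ?thesis
  proof cases
    case (gaussian C)
    then show ?thesis by (intro *[of C "1/2" 2]) auto
  next
    case (generalized_gaussian C \<beta>)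
    then show ?thesis by (intro *[of C 1 \<beta>]) auto
  next
    case (laplace C)
    then show ?thesis by (intro *[of C 1 1]) auto
  next
    case (sub_gaussian C a)
    then show ?thesis by (intro *[of C a 2]) auto
  qed
qed

text \<open>All entries are powers of \<open>1 + r ^ p / \<nu>\<close>. The explicit form of the
  factor is retained because polynomial growth in the dimension is derived from it.\<close>

lemma polynomial_noise_profile:
  assumes "polynomial_noise dy \<phi> \<psi>"
  shows "\<exists>A n. A > 0 \<and> radial_profile (\<lambda>r. \<phi> (\<psi> r)) 1 (\<lambda>s. A * (1 + s) ^ n)"
proof -
  have *: "\<exists>A n. A > 0 \<and> radial_profile (\<lambda>r. C * (1 + r ^ p / \<nu>) powr - \<alpha>) 1 (\<lambda>s. A * (1 + s) ^ n)"
    if "C > 0" "\<nu> > 0" "\<alpha> > 0" for C \<nu> \<alpha> p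
    using polynomial_profile[OF that, of p] that
    by (intro exI[of _ "(1 + 1 / \<nu>) powr \<alpha>"] exI[of _ "nat \<lceil>real p * \<alpha>\<rceil>"])
      (simp add: add_pos_pos less_imp_neq[symmetric])
  from assms show ?thesis
  proof cases
    case (student C \<nu>)
    then show ?thesis using *[of C \<nu> "(\<nu> + real dy) / 2" 2] by simp
  next
    case (cauchy C)
    then show ?thesis using *[of C 1 "(real dy + 1) / 2" 2] by simp
  next
    case (pearson_VII C \<theta> \<alpha>)
    then show ?thesis using *[of C \<theta> \<alpha> 2] by simp
  next
    case (generalized_cauchy C p \<alpha>)
    then show ?thesis using *[of C 1 \<alpha> p] by simp
  qed
qed

subsection \<open>Signals in additive radial noise\<close>

text \<open>Squaring removes the root in the finite and in the infinite case alike, so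
  \<open>K_two\<close> becomes an iterated integral.\<close>

lemma Ltwo_norm_power2: "(Ltwo_norm M f)\<^sup>2 = (\<integral>\<^sup>+ x. ennreal ((f x)\<^sup>2) \<partial>M)"
proof (cases "(\<integral>\<^sup>+ x. ennreal ((f x)\<^sup>2) \<partial>M) = \<infinity>")
  case True
  then show ?thesis by (simp add: Ltwo_norm_def Let_def power2_eq_square)
next
  case False
  then have "(\<integral>\<^sup>+ x. ennreal ((f x)\<^sup>2) \<partial>M) < top"
    by (simp add: less_top)
  with False show ?thesis
    by (simp add: Ltwo_norm_def Let_def ennreal_power)
qed

lemma Ltwo_norm_less_top_iff: "Ltwo_norm M f < \<infinity> \<longleftrightarrow> (\<integral>\<^sup>+ x. ennreal ((f x)\<^sup>2) \<partial>M) < \<infinity>"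
  by (auto simp: Ltwo_norm_def Let_def less_top[symmetric])

text \<open>Integrals that tend to 0 are eventually finite, so the norm is eventually given by the
  square root, which is continuous.\<close>

lemma Ltwo_norm_tendsto_0:
  assumes lim: "((\<lambda>n. \<integral>\<^sup>+ x. ennreal ((f n x)\<^sup>2) \<partial>M) \<longlongrightarrow> 0) G"
  shows "((\<lambda>n. Ltwo_norm M (f n)) \<longlongrightarrow> 0) G"
proof -
  have "((\<lambda>n. ennreal (sqrt (enn2real (\<integral>\<^sup>+ x. ennreal ((f n x)\<^sup>2) \<partial>M)))) \<longlongrightarrow> ennreal (sqrt (enn2real 0))) G"
    using lim by (intro tendsto_ennrealI tendsto_real_sqrt tendsto_enn2real) auto
  moreover have "eventually (\<lambda>n. (\<integral>\<^sup>+ x. ennreal ((f n x)\<^sup>2) \<partial>M) < \<infinity>) G"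
    using lim by (rule order_tendstoD) simp
  then have "eventually (\<lambda>n. ennreal (sqrt (enn2real (\<integral>\<^sup>+ x. ennreal ((f n x)\<^sup>2) \<partial>M))) =
      Ltwo_norm M (f n)) G"
    by eventually_elim (auto simp: Ltwo_norm_def Let_def)
  ultimately show ?thesis
    by (simp add: tendsto_cong)
qed

text \<open>One member of the family: \<open>M\<close> is the prior, \<open>B\<close> any bound on
  the \<open>R\<close>-norm of the signal, and the dimension of the parameter space no longer
  appears.\<close>

locale bounded_signal_model = prob_space M + radial_profile F c K
  for M :: "'x measure" and F c K +
  fixes R :: "real ^ 'm ^ 'm"
    and h :: "'x \<Rightarrow> real ^ 'm"
    and g :: "real ^ 'm \<Rightarrow> 'x \<Rightarrow> real"
    and B :: real
  assumes R: "sym_pos_def R"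
    and total: "(\<integral>\<^sup>+ v. ennreal (F (norm_wrt R v)) \<partial>lborel) = 1"
    and h_measurable [measurable]: "h \<in> borel_measurable M"
    and h_bound: "x \<in> space M \<Longrightarrow> norm_wrt R (h x) \<le> B"
    and likelihood: "x \<in> space M \<Longrightarrow> g y x = F (norm_wrt R (y - h x))"
begin

lemma bound_nonneg: "0 \<le> B"
proof -
  obtain x where "x \<in> space M" using not_empty by blast
  then show ?thesis using h_bound norm_wrt_nonneg[OF R] order_trans by blast
qed

lemma continuous_radial: "continuous_on UNIV (\<lambda>v. F (norm_wrt R v))"
  by (rule continuous_on_compose2[OF continuous continuous_norm_wrt]) (auto simp: norm_wrt_nonneg R)

lemma borel_measurable_radial [measurable]: "(\<lambda>v. F (norm_wrt R v)) \<in> borel_measurable borel"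
  by (rule borel_measurable_continuous_onI) (rule continuous_radial)

text \<open>Continuity of \<open>F\<close> is known only on the half-line; truncation by
  \<open>max 0 r\<close> yields a continuous function on the whole line.\<close>

lemma borel_measurable_profile_shift:
  assumes "0 \<le> s" "0 \<le> a"
  shows "(\<lambda>r. F (s + a * max 0 r)) \<in> borel_measurable borel"
  using assms
  by (intro borel_measurable_continuous_onI continuous_on_compose2[OF continuous] continuous_intros) auto

lemma borel_measurable_likelihood [measurable]: "g y \<in> borel_measurable M"
proof -
  have "(\<lambda>x. F (norm_wrt R (y - h x))) \<in> borel_measurable M"
    by measurable
  then show ?thesis using likelihood by (simp cong: measurable_cong)
qed

lemma borel_measurable_likelihood_pair [measurable]:
  "(\<lambda>(y, x). g y x) \<in> borel_measurable (borel \<Otimes>\<^sub>M M)"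
proof -
  have "(\<lambda>p. F (norm_wrt R (fst p - h (snd p)))) \<in> borel_measurable (borel \<Otimes>\<^sub>M M)"
    by measurable
  then show ?thesis
    by (rule measurable_cong[THEN iffD1, rotated]) (auto simp: space_pair_measure likelihood)
qed

lemma likelihood_pos: "x \<in> space M \<Longrightarrow> 0 < g y x"
  by (simp add: likelihood pos norm_wrt_nonneg R)

lemma likelihood_le: "x \<in> space M \<Longrightarrow> g y x \<le> F 0"
  by (simp add: likelihood antimono norm_wrt_nonneg R)

lemma integrable_likelihood: "integrable M (g y)"
  by (rule integrable_const_bound[of _ "F 0"])
    (auto intro!: AE_I2 simp: abs_of_pos likelihood_pos likelihood_le)

text \<open>Two signals differ by at most \<open>2 * B\<close> in \<open>R\<close>-norm, so each
  likelihood value \<open>g y x'\<close> exceeds the left-hand side; then average over the prior. As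
  \<open>x\<close> is arbitrary, it can be the integration variable in the bound on
  \<open>K_two\<close>.\<close>

lemma evidence_ge:
  assumes x: "x \<in> space M"
  shows "F (norm_wrt R (y - h x) + 2 * B) \<le> evidence M g y"
proof -
  have "F (norm_wrt R (y - h x) + 2 * B) \<le> g y x'" if x': "x' \<in> space M" for x'
  proof -
    have "norm_wrt R (y - h x') = norm_wrt R ((y - h x) + (h x + - h x'))"
      by simp
    also have "\<dots> \<le> norm_wrt R (y - h x) + (norm_wrt R (h x) + norm_wrt R (- h x'))"
      using norm_wrt_triangle[OF R] by (meson add_left_mono order_trans)
    also have "\<dots> \<le> norm_wrt R (y - h x) + 2 * B"
      using h_bound[OF x] h_bound[OF x'] by (simp add: norm_wrt_minus)
    finally show ?thesis
      unfolding likelihood[OF x'] by (intro antimono) (auto simp: norm_wrt_nonneg R)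
  qed
  then have "(\<integral>x'. F (norm_wrt R (y - h x) + 2 * B) \<partial>M) \<le> (\<integral>x'. g y x' \<partial>M)"
    by (intro integral_mono integrable_likelihood) auto
  then show ?thesis by (simp add: evidence_def prob_space)
qed

lemma evidence_pos: "0 < evidence M g y"
proof -
  obtain x where x: "x \<in> space M" using not_empty by blast
  have "0 < F (norm_wrt R (y - h x) + 2 * B)"
    using bound_nonneg by (intro pos add_nonneg_nonneg) (auto simp: norm_wrt_nonneg R)
  then show ?thesis using evidence_ge[OF x] by (rule less_le_trans)
qed

lemma borel_measurable_evidence [measurable]: "evidence M g \<in> borel_measurable borel"
  unfolding evidence_def by measurable

lemma ennreal_evidence: "ennreal (evidence M g y) = (\<integral>\<^sup>+ x. ennreal (g y x) \<partial>M)"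
  unfolding evidence_def
  by (intro nn_integral_eq_integral[symmetric] integrable_likelihood AE_I2)
    (simp add: likelihood_pos less_imp_le)

section \<open>The link function as a continuous map into the space of square-integrable
  functions\<close>

lemma link_le: "x \<in> space M \<Longrightarrow> link_fun M g y x \<le> F 0 / evidence M g y"
  using likelihood_le evidence_pos by (simp add: link_fun_def divide_right_mono less_imp_le)

lemma link_nonneg: "x \<in> space M \<Longrightarrow> 0 \<le> link_fun M g y x"
  using likelihood_pos evidence_pos by (simp add: link_fun_def less_imp_le)

lemma borel_measurable_link [measurable]: "link_fun M g y \<in> borel_measurable M"
  unfolding link_fun_def by measurable

lemma link_in_Ltwo: "link_fun M g y \<in> Ltwo M"
proof -
  have "(\<integral>\<^sup>+ x. ennreal ((link_fun M g y x)\<^sup>2) \<partial>M) \<le> (\<integral>\<^sup>+ x. ennreal ((F 0 / evidence M g y)\<^sup>2) \<partial>M)"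
    using link_le link_nonneg by (intro nn_integral_mono ennreal_leI power_mono) auto
  also have "\<dots> < \<infinity>" by (simp add: emeasure_space_1)
  finally show ?thesis
    by (simp add: Ltwo_def Ltwo_norm_less_top_iff[simplified])
qed

lemma likelihood_tendsto:
  assumes "s \<longlonglongrightarrow> y" and x: "x \<in> space M"
  shows "(\<lambda>n. g (s n) x) \<longlonglongrightarrow> g y x"
proof -
  have "(\<lambda>n. s n - h x) \<longlonglongrightarrow> y - h x"
    using assms by (intro tendsto_intros)
  from continuous_on_tendsto_compose[OF continuous_radial this] show ?thesis
    by (simp add: likelihood[OF x])
qed

lemma evidence_tendsto:
  assumes "s \<longlonglongrightarrow> y"
  shows "(\<lambda>n. evidence M g (s n)) \<longlonglongrightarrow> evidence M g y"
  unfolding evidence_def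
  by (rule integral_dominated_convergence[where w = "\<lambda>_. F 0"])
    (auto intro!: AE_I2 likelihood_tendsto assms simp: abs_of_pos likelihood_pos likelihood_le)

text \<open>Dominated convergence: the link functions converge pointwise, and the evidences converge
  to a positive limit, which gives a common constant bound.\<close>

lemma link_tendsto_Ltwo:
  assumes s: "s \<longlonglongrightarrow> y"
  shows "(\<lambda>n. Ltwo_norm M (\<lambda>x. link_fun M g (s n) x - link_fun M g y x)) \<longlonglongrightarrow> 0"
proof (rule Ltwo_norm_tendsto_0)
  note e = evidence_tendsto[OF s]
  have lim: "(\<lambda>n. link_fun M g (s n) x) \<longlonglongrightarrow> link_fun M g y x" if "x \<in> space M" for x
    unfolding link_fun_def using evidence_pos[of y]
    by (intro tendsto_divide likelihood_tendsto s that e) auto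
  \<comment> \<open>The pointwise bounds of the link functions themselves converge, hence are
    bounded by some \<open>b\<close>.\<close>
  have "(\<lambda>n. F 0 / evidence M g (s n)) \<longlonglongrightarrow> F 0 / evidence M g y"
    using evidence_pos[of y] by (intro tendsto_divide e tendsto_const) auto
  then have "Bseq (\<lambda>n. F 0 / evidence M g (s n))"
    by (intro convergent_imp_Bseq convergentI)
  then obtain b where b: "\<forall>n. norm (F 0 / evidence M g (s n)) \<le> b"
    by (rule BseqE)
  have dom: "\<bar>link_fun M g (s n) x - link_fun M g y x\<bar> \<le> b + F 0 / evidence M g y"
    if x: "x \<in> space M" for n x
  proof -
    have "\<bar>link_fun M g (s n) x - link_fun M g y x\<bar> \<le> \<bar>link_fun M g (s n) x\<bar> + \<bar>link_fun M g y x\<bar>"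
      by (rule abs_triangle_ineq4)
    also have "\<dots> \<le> F 0 / evidence M g (s n) + F 0 / evidence M g y"
      by (intro add_mono) (simp_all add: link_le link_nonneg x)
    also have "\<dots> \<le> b + F 0 / evidence M g y"
      using spec[OF b, of n] abs_ge_self[of "F 0 / evidence M g (s n)"]
      by (intro add_right_mono) (simp only: real_norm_def)
    finally show ?thesis .
  qed
  have "(\<lambda>n. \<integral>\<^sup>+ x. ennreal ((link_fun M g (s n) x - link_fun M g y x)\<^sup>2) \<partial>M) \<longlonglongrightarrow> (\<integral>\<^sup>+ x. 0 \<partial>M)"
  proof (rule nn_integral_dominated_convergence[where w = "\<lambda>_. ennreal ((b + F 0 / evidence M g y)\<^sup>2)"])
    show "AE x in M. ennreal ((link_fun M g (s n) x - link_fun M g y x)\<^sup>2)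
        \<le> ennreal ((b + F 0 / evidence M g y)\<^sup>2)" for n
    proof (intro AE_I2 ennreal_leI)
      fix x assume "x \<in> space M"
      have "\<bar>link_fun M g (s n) x - link_fun M g y x\<bar> \<le> \<bar>b + F 0 / evidence M g y\<bar>"
        by (rule order_trans[OF dom abs_ge_self]) fact
      then show "(link_fun M g (s n) x - link_fun M g y x)\<^sup>2 \<le> (b + F 0 / evidence M g y)\<^sup>2"
        by (simp only: abs_le_square_iff)
    qed
    show "AE x in M. (\<lambda>n. ennreal ((link_fun M g (s n) x - link_fun M g y x)\<^sup>2)) \<longlonglongrightarrow> 0"
    proof (rule AE_I2)
      fix x assume "x \<in> space M"
      from lim[OF this]
      have "(\<lambda>n. ennreal ((link_fun M g (s n) x - link_fun M g y x)\<^sup>2)) \<longlonglongrightarrow>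
          ennreal ((link_fun M g y x - link_fun M g y x)\<^sup>2)"
        by (intro tendsto_ennrealI tendsto_power tendsto_diff tendsto_const)
      then show "(\<lambda>n. ennreal ((link_fun M g (s n) x - link_fun M g y x)\<^sup>2)) \<longlonglongrightarrow> 0" by simp
    qed
  qed (auto simp: emeasure_space_1 ennreal_mult_less_top)
  then show "(\<lambda>n. \<integral>\<^sup>+ x. ennreal ((link_fun M g (s n) x - link_fun M g y x)\<^sup>2) \<partial>M) \<longlonglongrightarrow> 0"
    by simp
qed

text \<open>Simple functions approximating the identity on the data space stay simple after
  composition with the link map, and its continuity carries the convergence over to the
  \<open>Ltwo_norm\<close>.\<close>

lemma strongly_measurable_link: "strongly_measurable_Ltwo (data_law M g) M (link_fun M g)"
proof -
  have "(\<lambda>y. y) \<in> borel_measurable (data_law M g)"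
    by (simp add: data_law_def)
  then obtain s where s: "\<And>n. simple_function (data_law M g) (s n)"
    and lim: "\<And>y. y \<in> space (data_law M g) \<Longrightarrow> (\<lambda>n. s n y) \<longlonglongrightarrow> y"
    using borel_measurable_implies_sequence_metric[of "\<lambda>y. y" "data_law M g" 0] by metis
  have "simple_function (data_law M g) (\<lambda>y. link_fun M g (s n y))" for n
    using s by (rule simple_function_compose1)
  moreover have "AE y in data_law M g.
      (\<lambda>n. Ltwo_norm M (\<lambda>x. link_fun M g (s n y) x - link_fun M g y x)) \<longlonglongrightarrow> 0"
    using lim by (intro AE_I2 link_tendsto_Ltwo)
  ultimately show ?thesis
    unfolding strongly_measurable_Ltwo_def
    by (intro exI[of _ "\<lambda>n y. link_fun M g (s n y)"]) (simp add: link_in_Ltwo)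
qed

section \<open>Bounding the second moment of the link function\<close>

lemma borel_measurable_Ltwo_norm_link [measurable]:
  "(\<lambda>y. (Ltwo_norm M (link_fun M g y))\<^sup>2) \<in> borel_measurable borel"
  unfolding Ltwo_norm_power2 link_fun_def by measurable

lemma K_two_le: "K_two M g \<le> ennreal (K (2 * B) * c ^ CARD('m))"
proof -
  let ?G = "\<lambda>r. ennreal ((F r)\<^sup>2 / F (r + 2 * B))"
  have B: "0 \<le> 2 * B" using bound_nonneg by simp
  \<comment> \<open>The sign of \<open>K\<close> is no axiom of the profile; it follows from
    \<open>ratio_le\<close> at \<open>r = 0\<close>, where \<open>F\<close> is positive.\<close>
  have "0 \<le> (F 0)\<^sup>2 / F (0 + 2 * B)" using pos[of "2 * B"] B by simp
  also have "\<dots> \<le> K (2 * B) * F (0 / c)" using B by (intro ratio_le) auto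
  finally have K: "0 \<le> K (2 * B)" using pos[of 0] by (simp add: zero_le_mult_iff)
  have "K_two M g = (\<integral>\<^sup>+ y. ennreal (evidence M g y) * (\<integral>\<^sup>+ x. ennreal ((link_fun M g y x)\<^sup>2) \<partial>M) \<partial>lborel)"
    unfolding K_two_def data_law_def Ltwo_norm_power2[symmetric]
    by (subst nn_integral_density) auto
  also have "\<dots> = (\<integral>\<^sup>+ y. (\<integral>\<^sup>+ x. ennreal (evidence M g y) * ennreal ((link_fun M g y x)\<^sup>2) \<partial>M) \<partial>lborel)"
    by (intro nn_integral_cong nn_integral_cmult[symmetric]) simp
  \<comment> \<open>The density of the data law cancels one of the two evidences in the denominator.
    Bounding the other from below by \<open>evidence_ge\<close> at the same \<open>x\<close> leaves
    a function of \<open>y - h x\<close> alone.\<close>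
  also have "\<dots> \<le> (\<integral>\<^sup>+ y. (\<integral>\<^sup>+ x. ?G (norm_wrt R (y - h x)) \<partial>M) \<partial>lborel)"
  proof (intro nn_integral_mono)
    fix y x assume x: "x \<in> space M"
    have "ennreal (evidence M g y) * ennreal ((link_fun M g y x)\<^sup>2) = ennreal ((g y x)\<^sup>2 / evidence M g y)"
      using evidence_pos[of y]
      by (simp add: link_fun_def ennreal_mult[symmetric] power2_eq_square field_simps)
    also have "\<dots> \<le> ?G (norm_wrt R (y - h x))"
      unfolding likelihood[OF x] using evidence_ge[OF x, of y] B
      by (intro ennreal_leI divide_left_mono mult_pos_pos evidence_pos pos add_nonneg_nonneg)
        (auto simp: norm_wrt_nonneg R)
    finally show "ennreal (evidence M g y) * ennreal ((link_fun M g y x)\<^sup>2) \<le> ?G (norm_wrt R (y - h x))" .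
  qed
  also have "\<dots> \<le> (\<integral>\<^sup>+ y. (\<integral>\<^sup>+ x. ennreal (K (2 * B)) * ennreal (F (norm_wrt R ((1 / c) *\<^sub>R (y - h x)))) \<partial>M) \<partial>lborel)"
  proof (intro nn_integral_mono)
    fix y x
    have "?G (norm_wrt R (y - h x)) \<le> ennreal (K (2 * B) * F (norm_wrt R (y - h x) / c))"
      using B by (intro ennreal_leI ratio_le) (auto simp: norm_wrt_nonneg R)
    then show "?G (norm_wrt R (y - h x)) \<le>
        ennreal (K (2 * B)) * ennreal (F (norm_wrt R ((1 / c) *\<^sub>R (y - h x))))"
      using scale_pos K by (simp add: norm_wrt_scaleR ennreal_mult')
  qed
  also have "\<dots> = (\<integral>\<^sup>+ x. (\<integral>\<^sup>+ y. ennreal (K (2 * B)) * ennreal (F (norm_wrt R ((1 / c) *\<^sub>R (y - h x)))) \<partial>lborel) \<partial>M)"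
  proof -
    interpret pair_sigma_finite lborel M by standard
    show ?thesis by (rule Fubini'[symmetric]) measurable
  qed
  also have "\<dots> = (\<integral>\<^sup>+ x. ennreal (K (2 * B) * c ^ CARD('m)) \<partial>M)"
  proof (rule nn_integral_cong)
    fix x
    \<comment> \<open>The substitution \<open>y = h x + c *\<^sub>R v\<close> reduces the integral
      to the normalization \<open>total\<close>, with Jacobian \<open>c ^ CARD('m)\<close>.\<close>
    have "(\<integral>\<^sup>+ y. ennreal (F (norm_wrt R ((1 / c) *\<^sub>R (y - h x)))) \<partial>lborel) = ennreal (c ^ CARD('m))"
      using nn_integral_lborel_affine[of "\<lambda>y. ennreal (F (norm_wrt R ((1 / c) *\<^sub>R (y - h x))))" c "h x"]
        scale_pos total by simp
    then show "(\<integral>\<^sup>+ y. ennreal (K (2 * B)) * ennreal (F (norm_wrt R ((1 / c) *\<^sub>R (y - h x)))) \<partial>lborel) =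
        ennreal (K (2 * B) * c ^ CARD('m))"
      using scale_pos K by (simp add: nn_integral_cmult ennreal_mult)
  qed
  also have "\<dots> = ennreal (K (2 * B) * c ^ CARD('m))"
    by (simp add: emeasure_space_1)
  finally show ?thesis .
qed

lemma K_two_finite: "K_two M g < \<infinity>"
  using K_two_le by (rule le_less_trans) simp

lemma bochner_link: "bochner_two_integrable (data_law M g) M (link_fun M g)"
  unfolding bochner_two_integrable_def
  using link_in_Ltwo strongly_measurable_link K_two_finite by (simp add: K_two_def)

section \<open>Finiteness of the one-dimensional integral\<close>

lemma radial_ball_finite: "emeasure lborel {v. norm_wrt R v \<le> 1} < \<infinity>"
proof (rule ccontr)
  assume "\<not> emeasure lborel {v. norm_wrt R v \<le> 1} < \<infinity>"
  then have top: "emeasure lborel {v. norm_wrt R v \<le> 1} = \<infinity>" by (simp add: not_less_iff_gr_or_eq less_top[symmetric])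
  \<comment> \<open>On the unit ball the density is at least \<open>F 1 > 0\<close>, while its total
    mass is one.\<close>
  have "(\<integral>\<^sup>+ v. ennreal (F 1) * indicator {v. norm_wrt R v \<le> 1} v \<partial>lborel) \<le> 1"
    unfolding total[symmetric]
    by (intro nn_integral_mono) (auto intro!: ennreal_leI antimono simp: norm_wrt_nonneg R split: split_indicator)
  then show False
    using pos[of 1] top by (simp add: nn_integral_cmult_indicator ennreal_mult_top top_unique)
qed

text \<open>The integrand is dominated by \<open>K (2 * B) * F (r / c)\<close> times the power of
  \<open>r\<close>. The integral \<open>I\<close> of this majorant without the constant is found by
  reading polar coordinates backwards, from the known integral over the data space.\<close>

lemma set_integrable_radial_ratio:
  "set_integrable lborel {0<..} (\<lambda>r. (F r)\<^sup>2 / F (r + 2 * B) * r ^ (CARD('m) - 1))"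
proof -
  let ?b = "emeasure lborel {v. norm_wrt R v \<le> 1}"
  define I where "I = (\<integral>\<^sup>+ r. ennreal (F (max 0 r / c)) * ennreal (r ^ (CARD('m) - 1)) * indicator {0<..} r \<partial>lborel)"
  have B: "0 \<le> 2 * B" using bound_nonneg by simp
  have meas: "(\<lambda>r. F (max 0 r / c)) \<in> borel_measurable borel"
    using borel_measurable_profile_shift[of 0 "1 / c"] scale_pos by simp
  have [measurable]: "(\<lambda>v. F (norm_wrt R v / c)) \<in> borel_measurable borel"
    using measurable_compose[OF borel_measurable_norm_wrt meas, of R]
    by (simp add: max_absorb2 norm_wrt_nonneg R)
  note [measurable] = borel_measurable_profile_shift[of 0 1, simplified]
    borel_measurable_profile_shift[OF B, of 1, simplified] meas
  have "?b * ennreal (real CARD('m)) * I = (\<integral>\<^sup>+ v. ennreal (F (max 0 (norm_wrt R v) / c)) \<partial>lborel)"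
    unfolding I_def
    by (rule nn_integral_norm_wrt[OF R radial_ball_finite, symmetric]) measurable
  also have "\<dots> = ennreal (c ^ CARD('m))"
    using nn_integral_lborel_affine[of "\<lambda>v. ennreal (F (norm_wrt R v / c))" c 0] scale_pos total
    by (simp add: norm_wrt_scaleR max_absorb2 norm_wrt_nonneg R)
  finally have "?b * ennreal (real CARD('m)) * I < \<infinity>" by simp
  \<comment> \<open>The two factors in front of \<open>I\<close> are positive, so \<open>I\<close>
    cannot be infinite.\<close>
  then have I: "I < \<infinity>"
    using emeasure_norm_wrt_ball_pos[of R] by (auto simp: ennreal_mult_less_top)
  let ?f = "\<lambda>r. indicator {0<..} r *\<^sub>R ((F r)\<^sup>2 / F (r + 2 * B) * r ^ (CARD('m) - 1))"
  have "integrable lborel ?f"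
  proof (rule integrableI_bounded)
    \<comment> \<open>Off the half-line \<open>F\<close> need not be measurable; the truncated
      version agrees with \<open>?f\<close> because of the indicator.\<close>
    have "(\<lambda>r. indicator {0<..} r *\<^sub>R ((F (max 0 r))\<^sup>2 / F (2 * B + max 0 r) * r ^ (CARD('m) - 1)))
        \<in> borel_measurable lborel"
      by measurable
    also have "(\<lambda>r. indicator {0<..} r *\<^sub>R ((F (max 0 r))\<^sup>2 / F (2 * B + max 0 r) * r ^ (CARD('m) - 1))) = ?f"
      by (auto simp: fun_eq_iff max_absorb2 add.commute split: split_indicator)
    finally show "?f \<in> borel_measurable lborel" .
    have "(\<integral>\<^sup>+ r. ennreal (norm (?f r)) \<partial>lborel) \<le> (\<integral>\<^sup>+ r. ennreal (K (2 * B)) *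
        (ennreal (F (max 0 r / c)) * ennreal (r ^ (CARD('m) - 1)) * indicator {0<..} r) \<partial>lborel)"
    proof (rule nn_integral_mono)
      fix r
      show "ennreal (norm (?f r)) \<le> ennreal (K (2 * B)) *
        (ennreal (F (max 0 r / c)) * ennreal (r ^ (CARD('m) - 1)) * indicator {0<..} r)"
      proof (cases "r > 0")
        case True
        have Fc: "0 < F (r / c)" using True scale_pos by (intro pos) simp
        have q: "(F r)\<^sup>2 / F (r + 2 * B) \<le> K (2 * B) * F (r / c)"
          using True B by (intro ratio_le) auto
        have q0: "0 \<le> (F r)\<^sup>2 / F (r + 2 * B)"
          using True B pos[of "r + 2 * B"] by simp
        then have "0 \<le> K (2 * B)" using q Fc by (meson order_trans zero_le_mult_iff not_less)
        then have "norm (?f r) \<le> K (2 * B) * (F (r / c) * r ^ (CARD('m) - 1))"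
          using mult_right_mono[OF q, of "r ^ (CARD('m) - 1)"] True pos[of "r + 2 * B"] B
          by (simp add: mult.assoc)
        from ennreal_leI[OF this] show ?thesis
          using True Fc \<open>0 \<le> K (2 * B)\<close> by (simp add: max_absorb2 ennreal_mult del: real_norm_def)
      qed simp
    qed
    also have "\<dots> = ennreal (K (2 * B)) * I"
      unfolding I_def by (rule nn_integral_cmult) measurable
    also have "\<dots> < \<infinity>" using I by (simp add: ennreal_mult_less_top)
    finally show "(\<integral>\<^sup>+ r. ennreal (norm (?f r)) \<partial>lborel) < \<infinity>" .
  qed
  then show ?thesis by (simp add: set_integrable_def)
qed

text \<open>Identifies the law of the observation with \<open>data_law\<close>, so that
  \<open>K_two\<close> is an expectation. Translating the noise density by the signal gives the
  likelihood, and averaging the likelihood over the prior gives the evidence.\<close>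

lemma nn_integral_observation:
  assumes W: "prob_space W"
    and \<xi> [measurable]: "\<xi> \<in> W \<rightarrow>\<^sub>M M" and \<xi>_law: "distr W M \<xi> = M"
    and V_law: "distributed W lborel V (\<lambda>v. ennreal (F (norm_wrt R v)))"
    and indep: "independent_rvs W M \<xi> borel V"
    and f [measurable]: "f \<in> borel_measurable borel"
  shows "(\<integral>\<^sup>+ \<omega>. f (h (\<xi> \<omega>) + V \<omega>) \<partial>W) = (\<integral>\<^sup>+ y. f y \<partial>data_law M g)"
proof -
  interpret W: prob_space W by fact
  define D where "D = density lborel (\<lambda>v. ennreal (F (norm_wrt R v)))"
  have V [measurable]: "V \<in> W \<rightarrow>\<^sub>M borel"
    using V_law by (simp add: distributed_def)
  have sets_D [measurable_cong]: "sets D = sets borel" by (simp add: D_def)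
  have V_distr: "distr W borel V = D"
    using V_law by (simp add: distributed_def D_def cong: distr_cong)
  interpret D: prob_space D
    unfolding V_distr[symmetric] by (rule W.prob_space_distr) simp
  \<comment> \<open>Independence is a product formula on rectangles, which determine the joint
    law.\<close>
  have "M \<Otimes>\<^sub>M D = distr W (M \<Otimes>\<^sub>M borel) (\<lambda>\<omega>. (\<xi> \<omega>, V \<omega>))"
  proof (rule pair_measure_eqI)
    show "sigma_finite_measure M" by (rule sigma_finite_measure_axioms)
    show "sigma_finite_measure D" by (rule D.sigma_finite_measure_axioms)
    show "sets (M \<Otimes>\<^sub>M D) = sets (distr W (M \<Otimes>\<^sub>M borel) (\<lambda>\<omega>. (\<xi> \<omega>, V \<omega>)))"
      by (simp add: sets_D cong: sets_pair_measure_cong)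
    fix S T assume S: "S \<in> sets M" and "T \<in> sets D"
    then have T: "T \<in> sets borel" by (simp add: sets_D)
    have "W.prob ((\<xi> -` S \<inter> space W) \<inter> (V -` T \<inter> space W)) =
        W.prob (\<xi> -` S \<inter> space W) * W.prob (V -` T \<inter> space W)"
      using indep S T unfolding independent_rvs_def by (intro W.indep_setD) auto
    moreover have "emeasure M S = emeasure W (\<xi> -` S \<inter> space W)"
      using S by (subst \<xi>_law[symmetric]) (simp add: emeasure_distr)
    moreover have "emeasure D T = emeasure W (V -` T \<inter> space W)"
      using T unfolding V_distr[symmetric] by (simp add: emeasure_distr)
    moreover have "(\<lambda>\<omega>. (\<xi> \<omega>, V \<omega>)) -` (S \<times> T) \<inter> space W =
        (\<xi> -` S \<inter> space W) \<inter> (V -` T \<inter> space W)"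
      by auto
    ultimately show "emeasure M S * emeasure D T =
        emeasure (distr W (M \<Otimes>\<^sub>M borel) (\<lambda>\<omega>. (\<xi> \<omega>, V \<omega>))) (S \<times> T)"
      using S T by (simp add: emeasure_distr W.emeasure_eq_measure ennreal_mult)
  qed
  then have "(\<integral>\<^sup>+ \<omega>. f (h (\<xi> \<omega>) + V \<omega>) \<partial>W) = (\<integral>\<^sup>+ p. f (h (fst p) + snd p) \<partial>(M \<Otimes>\<^sub>M D))"
    by (simp add: nn_integral_distr)
  also have "\<dots> = (\<integral>\<^sup>+ x. \<integral>\<^sup>+ v. f (h x + v) \<partial>D \<partial>M)"
    by (subst D.nn_integral_fst[symmetric]) auto
  also have "\<dots> = (\<integral>\<^sup>+ x. \<integral>\<^sup>+ y. ennreal (g y x) * f y \<partial>lborel \<partial>M)"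
  proof (rule nn_integral_cong)
    fix x assume x: "x \<in> space M"
    have "(\<integral>\<^sup>+ v. f (h x + v) \<partial>D) = (\<integral>\<^sup>+ v. ennreal (F (norm_wrt R v)) * f (h x + v) \<partial>lborel)"
      unfolding D_def by (rule nn_integral_density) auto
    also have "\<dots> = (\<integral>\<^sup>+ y. ennreal (F (norm_wrt R (y - h x))) * f y \<partial>lborel)"
      using nn_integral_lborel_affine[of "\<lambda>y. ennreal (F (norm_wrt R (y - h x))) * f y" 1 "h x"] by simp
    finally show "(\<integral>\<^sup>+ v. f (h x + v) \<partial>D) = (\<integral>\<^sup>+ y. ennreal (g y x) * f y \<partial>lborel)"
      by (simp add: likelihood[OF x])
  qed
  also have "\<dots> = (\<integral>\<^sup>+ y. \<integral>\<^sup>+ x. ennreal (g y x) * f y \<partial>M \<partial>lborel)"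
  proof -
    interpret pair_sigma_finite lborel M by standard
    show ?thesis by (rule Fubini') measurable
  qed
  also have "\<dots> = (\<integral>\<^sup>+ y. ennreal (evidence M g y) * f y \<partial>lborel)"
    by (simp add: nn_integral_multc ennreal_evidence)
  also have "\<dots> = (\<integral>\<^sup>+ y. f y \<partial>data_law M g)"
    unfolding data_law_def by (rule nn_integral_density[symmetric]) auto
  finally show ?thesis .
qed

end

section \<open>From a single model to the family indexed by the dimension\<close>

theorem corollary4p2:
  fixes R :: "real ^ 'm ^ 'm"
    and \<phi> \<psi> :: "real \<Rightarrow> real"
    and X :: "nat \<Rightarrow> (nat \<Rightarrow> real) set"
    and \<pi>0 :: "nat \<Rightarrow> (nat \<Rightarrow> real) measure"
    and h :: "nat \<Rightarrow> (nat \<Rightarrow> real) \<Rightarrow> real ^ 'm"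
    and g :: "nat \<Rightarrow> real ^ 'm \<Rightarrow> (nat \<Rightarrow> real) \<Rightarrow> real"
    and \<Omega> :: "nat \<Rightarrow> 'w measure"
    and \<xi> :: "nat \<Rightarrow> 'w \<Rightarrow> nat \<Rightarrow> real"
    and V :: "nat \<Rightarrow> 'w \<Rightarrow> real ^ 'm"
  assumes R: "sym_pos_def R"
    and noise: "exponential_noise \<phi> \<psi> \<or> polynomial_noise CARD('m) \<phi> \<psi>"
    and normalized: "(\<integral>\<^sup>+ v. ennreal (\<phi> (\<psi> (norm_wrt R v))) \<partial>lborel) = 1"
    and X_borel: "\<And>d. X d \<in> sets (borel_Rn d)"
    and prior_prob: "\<And>d. prob_space (\<pi>0 d)"
    and prior_sets: "\<And>d. sets (\<pi>0 d) = sets (restrict_space (borel_Rn d) (X d))"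
    and h_measurable: "\<And>d. h d \<in> restrict_space (borel_Rn d) (X d) \<rightarrow>\<^sub>M borel"
    and h_bounded: "\<And>d. bdd_above ((\<lambda>x. norm (h d x)) ` X d)"
    and likelihood: "\<And>d x y. x \<in> X d \<Longrightarrow> g d y x = \<phi> (\<psi> (norm_wrt R (y - h d x)))"
    and Omega_prob: "\<And>d. prob_space (\<Omega> d)"
    and xi_measurable: "\<And>d. \<xi> d \<in> \<Omega> d \<rightarrow>\<^sub>M \<pi>0 d"
    and xi_law: "\<And>d. distr (\<Omega> d) (\<pi>0 d) (\<xi> d) = \<pi>0 d"
    and V_law: "\<And>d. distributed (\<Omega> d) lborel (V d) (\<lambda>v. ennreal (\<phi> (\<psi> (norm_wrt R v))))"
    and xi_V_indep: "\<And>d. independent_rvs (\<Omega> d) (\<pi>0 d) (\<xi> d) borel (V d)"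
  shows "(\<forall>d. set_integrable lborel {0<..}
               (\<lambda>r. (\<phi> (\<psi> r))\<^sup>2 / \<phi> (\<psi> (r + 2 * (SUP x\<in>X d. norm_wrt R (h d x))))
                     * r ^ (CARD('m) - 1))
           \<and> K_two (\<pi>0 d) (g d) =
               (\<integral>\<^sup>+ \<omega>. (Ltwo_norm (\<pi>0 d) (link_fun (\<pi>0 d) (g d) (h d (\<xi> d \<omega>) + V d \<omega>)))\<^sup>2 \<partial>\<Omega> d)
           \<and> K_two (\<pi>0 d) (g d) < \<infinity>
           \<and> bochner_two_integrable (data_law (\<pi>0 d) (g d)) (\<pi>0 d) (link_fun (\<pi>0 d) (g d)))
       \<and> ((\<exists>M::real. \<forall>d. (SUP x\<in>X d. norm (h d x)) \<le> M) \<longrightarrow>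
           (\<exists>\<K>::real. (SUP d. K_two (\<pi>0 d) (g d)) \<le> ennreal \<K>))
       \<and> (polynomial_noise CARD('m) \<phi> \<psi> \<and>
         (\<exists>P :: real poly. \<forall>d. (SUP x\<in>X d. norm (h d x)) \<le> poly P (real d)) \<longrightarrow>
           (\<exists>Q :: real poly. \<forall>d. K_two (\<pi>0 d) (g d) \<le> ennreal (poly Q (real d))))"
proof -
  define B where "B = (\<lambda>d. SUP x\<in>X d. norm_wrt R (h d x))"
  define S where "S = (\<lambda>d. SUP x\<in>X d. norm (h d x))"
  obtain k where k: "k > 0" "\<And>v. norm_wrt R v \<le> k * norm v"
    by (rule norm_wrt_le_norm[of R]) blast
  have space: "space (\<pi>0 d) = X d" for d
    using sets_eq_imp_space_eq[OF prior_sets, of d] sets.sets_into_space[OF X_borel, of d]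
    by (auto simp: space_restrict_space)
  have le_S: "norm_wrt R (h d x) \<le> k * S d" if "x \<in> X d" for d x
  proof -
    have "norm (h d x) \<le> S d"
      unfolding S_def using that by (rule cSUP_upper) (rule h_bounded)
    then have "k * norm (h d x) \<le> k * S d" using k(1) by simp
    with k(2)[of "h d x"] show ?thesis by linarith
  qed
  \<comment> \<open>Needed to bound the supremum \<open>B d\<close> from above; a probability
    measure cannot live on the empty set.\<close>
  have nonempty: "X d \<noteq> {}" for d
    using prob_space.not_empty[OF prior_prob] by (simp add: space)
  have bdd: "bdd_above ((\<lambda>x. norm_wrt R (h d x)) ` X d)" for d
    using le_S by (rule bdd_aboveI2)
  have B_le: "B d \<le> k * S d" for d
    unfolding B_def using nonempty le_S by (rule cSUP_least)
  have B_bound: "norm_wrt R (h d x) \<le> B d" if "x \<in> X d" for d x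
    unfolding B_def using that by (rule cSUP_upper) (rule bdd)
  \<comment> \<open>Stated for arbitrary \<open>c\<close> and \<open>K\<close>, since the polynomial
    claim uses its own choice of them.\<close>
  have model: "bounded_signal_model (\<pi>0 d) (\<lambda>r. \<phi> (\<psi> r)) c K R (h d) (g d) (B d)"
    if "radial_profile (\<lambda>r. \<phi> (\<psi> r)) c K" for d c K
  proof -
    interpret P: prob_space "\<pi>0 d" by (rule prior_prob)
    interpret radial_profile "\<lambda>r. \<phi> (\<psi> r)" c K by fact
    have "h d \<in> borel_measurable (\<pi>0 d)"
      using h_measurable measurable_cong_sets[OF prior_sets refl] by blast
    then show ?thesis
      by unfold_locales (use R normalized B_bound likelihood in \<open>auto simp: space\<close>)
  qed
  \<comment> \<open>Fixed before any \<open>d\<close>, so every constant built from \<open>c\<close>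
    and \<open>K\<close> is independent of the dimension.\<close>
  obtain c K where profile: "radial_profile (\<lambda>r. \<phi> (\<psi> r)) c K"
    using noise exponential_noise_profile polynomial_noise_profile by blast
  have each: "set_integrable lborel {0<..}
        (\<lambda>r. (\<phi> (\<psi> r))\<^sup>2 / \<phi> (\<psi> (r + 2 * B d)) * r ^ (CARD('m) - 1))
      \<and> K_two (\<pi>0 d) (g d) =
        (\<integral>\<^sup>+ \<omega>. (Ltwo_norm (\<pi>0 d) (link_fun (\<pi>0 d) (g d) (h d (\<xi> d \<omega>) + V d \<omega>)))\<^sup>2 \<partial>\<Omega> d)
      \<and> K_two (\<pi>0 d) (g d) < \<infinity>
      \<and> bochner_two_integrable (data_law (\<pi>0 d) (g d)) (\<pi>0 d) (link_fun (\<pi>0 d) (g d))" for d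
  proof -
    interpret bounded_signal_model "\<pi>0 d" "\<lambda>r. \<phi> (\<psi> r)" c K R "h d" "g d" "B d"
      using profile by (rule model)
    show ?thesis
      unfolding K_two_def
        nn_integral_observation[OF Omega_prob xi_measurable xi_law V_law xi_V_indep
          borel_measurable_Ltwo_norm_link]
      using set_integrable_radial_ratio K_two_finite bochner_link by (simp add: K_two_def)
  qed
  have uniform: "\<exists>\<K>::real. (SUP d. K_two (\<pi>0 d) (g d)) \<le> ennreal \<K>" if M: "\<And>d. S d \<le> M" for M
  proof (intro exI SUP_least)
    fix d
    interpret bounded_signal_model "\<pi>0 d" "\<lambda>r. \<phi> (\<psi> r)" c K R "h d" "g d" "B d"
      using profile by (rule model)
    have "B d \<le> k * M"
      using B_le[of d] mult_left_mono[OF M[of d], of k] k(1) by linarith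
    then have "K (2 * B d) \<le> K (2 * (k * M))"
      using bound_nonneg by (intro factor_mono) auto
    then have "ennreal (K (2 * B d) * c ^ CARD('m)) \<le> ennreal (K (2 * (k * M)) * c ^ CARD('m))"
      using scale_pos by (intro ennreal_leI mult_right_mono) auto
    with K_two_le show "K_two (\<pi>0 d) (g d) \<le> ennreal (K (2 * (k * M)) * c ^ CARD('m))"
      by (rule order_trans)
  qed
  have poly: "\<exists>Q :: real poly. \<forall>d. K_two (\<pi>0 d) (g d) \<le> ennreal (poly Q (real d))"
    if noise': "polynomial_noise CARD('m) \<phi> \<psi>" and P: "\<And>d. S d \<le> poly P (real d)" for P
  proof -
    \<comment> \<open>The generic \<open>K\<close> is only monotone; here one of polynomial form,
      with scale 1, is chosen anew.\<close>
    obtain A n where A: "A > 0"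
      and profile': "radial_profile (\<lambda>r. \<phi> (\<psi> r)) 1 (\<lambda>s. A * (1 + s) ^ n)"
      using polynomial_noise_profile[OF noise'] by blast
    \<comment> \<open>The polynomial is \<open>A * (1 + s) ^ n\<close> at
      \<open>s = 2 * k * P\<close>, an upper bound for \<open>2 * B d\<close>.\<close>
    have "K_two (\<pi>0 d) (g d) \<le> ennreal (poly (smult A ((1 + smult (2 * k) P) ^ n)) (real d))" for d
    proof -
      interpret bounded_signal_model "\<pi>0 d" "\<lambda>r. \<phi> (\<psi> r)" 1 "\<lambda>s. A * (1 + s) ^ n" R "h d" "g d" "B d"
        using profile' by (rule model)
      have "B d \<le> k * poly P (real d)"
        using B_le[of d] mult_left_mono[OF P[of d], of k] k(1) by linarith
      then have "A * (1 + 2 * B d) ^ n \<le> A * (1 + 2 * k * poly P (real d)) ^ n"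
        using bound_nonneg A by (intro mult_left_mono power_mono) auto
      then have "ennreal (A * (1 + 2 * B d) ^ n * 1 ^ CARD('m)) \<le>
          ennreal (poly (smult A ((1 + smult (2 * k) P) ^ n)) (real d))"
        by (simp add: ennreal_leI)
      with K_two_le show ?thesis by (rule order_trans)
    qed
    then show ?thesis by blast
  qed
  show ?thesis
    using each uniform poly unfolding B_def S_def by blast
qed

end
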